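(* Let $n\in\mathbb{N}$, $1<p<\infty$, $\alpha>np-1$, and let $f\in Q_h(n,p,\alpha)$. Then, for every $0<r<1$, $$\int_{C_r}|f(z)|^p(1-|z|^2)^{\alpha+1-np}\,|dz|\le 2\pi r(\alpha+1-np)\int_{\mathbb{D}}|f(z)|^p(1-|z|^2)^{\alpha-np}\,dA(z),$$ where $C_r=\{z\in\mathbb{D}:|z|=r\}$.
   Context: $\mathbb{D}=\{z\in\mathbb{C}:|z|<1\}$, $\mathbb{N}=\{1,2,3,\dots\}$. $dA(z)=\frac{1}{\pi}\,dx\,dy$ is normalized area measure on $\mathbb{D}$. For $a\in\mathbb{D}$, $\sigma_a(z)=\frac{a-z}{1-\overline{a}z}$. For $0<p<\infty$, $\alpha>-1$, $n\in\mathbb{N}$, $Q_h(n,p,\alpha)$ is the set of complex-valued harmonic functions $f=h+\overline{g}$ on $\mathbb{D}$ ($h,g$ analytic) with $\sup_{a\in\mathbb{D}}\int_{\mathbb{D}}\left(|(h\circ\sigma_a)^{(n)}(z)|+|(g\circ\sigma_a)^{(n)}(z)|\right)^p(1-|z|^2)^\alpha\,dA(z)<\infty$. $|dz|$ is arc length. *)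

theory Defs
  imports "HOL-Complex_Analysis.Complex_Analysis"
begin

abbreviation unit_disk :: "complex set" where
  "unit_disk \<equiv> ball 0 1"

definition disk_area :: "complex measure" where
  "disk_area = scale_measure (ennreal (1 / pi)) (restrict_space lborel unit_disk)"

definition disk_auto :: "complex \<Rightarrow> complex \<Rightarrow> complex" where
  "disk_auto a z = (a - z) / (1 - cnj a * z)"

text \<open>
  The defining supremum, for the decomposition of a harmonic function as \<open>h + cnj g\<close>. Its
  value is an extended nonnegative real, so that its finiteness is a genuine condition.
\<close>

definition Qh_sup ::
    "nat \<Rightarrow> real \<Rightarrow> real \<Rightarrow> (complex \<Rightarrow> complex) \<Rightarrow> (complex \<Rightarrow> complex) \<Rightarrow> ennreal" where
  "Qh_sup n p \<alpha> h g =
     (SUP a \<in> unit_disk.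
        \<integral>\<^sup>+ z. ennreal ((norm ((deriv ^^ n) (h \<circ> disk_auto a) z) +
                        norm ((deriv ^^ n) (g \<circ> disk_auto a) z)) powr p *
                       (1 - (norm z)\<^sup>2) powr \<alpha>) \<partial>disk_area)"

text \<open>
  Elements are functions on the disk, represented by total functions whose values outside the disk
  are irrelevant. The decomposition \<open>f = h + cnj g\<close> is unique up to an additive constant, which
  does not affect the derivatives for \<open>n \<ge> 1\<close>.
\<close>

definition Qh :: "nat \<Rightarrow> real \<Rightarrow> real \<Rightarrow> (complex \<Rightarrow> complex) set" where
  "Qh n p \<alpha> =
     {f. \<exists>h g. h holomorphic_on unit_disk \<and> g holomorphic_on unit_disk \<and>
            (\<forall>z \<in> unit_disk. f z = h z + cnj (g z)) \<and>
            Qh_sup n p \<alpha> h g < \<infinity>}"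

text \<open>
  The integral of a nonnegative function with respect to arc length, \<open>|dz|\<close>, along a path
  parametrised over the unit interval, as for the contour integrals of the library.
\<close>

definition arc_length_integral :: "(real \<Rightarrow> complex) \<Rightarrow> (complex \<Rightarrow> ennreal) \<Rightarrow> ennreal" where
  "arc_length_integral \<gamma> F =
     (\<integral>\<^sup>+ t \<in> {0..1}. F (\<gamma> t) *
        ennreal (norm (vector_derivative \<gamma> (at t within {0..1}))) \<partial>lborel)"

end

theory Submission
  imports Defs
begin

text \<open>
  A harmonic function is the Poisson integral of its values on a larger circle, so Jensen's
  inequality and the symmetry of the Poisson kernel make the circular means of \<open>\<bar>f\<bar> powr p\<close>
  increase with the radius. Averaging the area integral over all rotations replaces
  \<open>\<bar>f z\<bar> powr p\<close> by its mean over the circle of radius \<open>\<bar>z\<bar>\<close>; on the annulus \<open>r < \<bar>z\<bar> < 1\<close>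
  this is at least the mean over \<open>C\<^sub>r\<close>, and with \<open>b = \<alpha> - n * p\<close> the integral of
  \<open>(1 - \<bar>z\<bar>\<^sup>2) powr b\<close> over the annulus is \<open>pi * (1 - r\<^sup>2) powr (b + 1) / (b + 1)\<close>.
\<close>

section \<open>Invariance of Lebesgue measure under translations and orthogonal maps\<close>

lemma nn_integral_lborel_shift:
  fixes F :: "'a::euclidean_space \<Rightarrow> ennreal"
  assumes [measurable]: "F \<in> borel_measurable borel"
  shows "(\<integral>\<^sup>+x. F (a + x) \<partial>lborel) = (\<integral>\<^sup>+x. F x \<partial>lborel)"
proof -
  have "(\<integral>\<^sup>+x. F x \<partial>lborel) = (\<integral>\<^sup>+x. F x \<partial>distr lborel borel ((+) a))"
    by (simp add: lborel_distr_plus)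
  also have "\<dots> = (\<integral>\<^sup>+x. F (a + x) \<partial>lborel)"
    by (subst nn_integral_distr) simp_all
  finally show ?thesis by simp
qed

text \<open>
  The uniqueness argument for Haar measure: Tonelli and translation invariance applied to
  \<open>F (T x) * B (y - T x)\<close>, with \<open>B\<close> the indicator of the unit ball, which \<open>T\<close> preserves.
\<close>

lemma nn_integral_lborel_orthogonal:
  fixes T :: "'a::euclidean_space \<Rightarrow> 'a" and F :: "'a \<Rightarrow> ennreal"
  assumes T: "orthogonal_transformation T" and F[measurable]: "F \<in> borel_measurable borel"
  shows "(\<integral>\<^sup>+x. F (T x) \<partial>lborel) = (\<integral>\<^sup>+x. F x \<partial>lborel)"
proof -
  define B :: "'a \<Rightarrow> ennreal" where "B = indicator (ball 0 1)"
  define vol where "vol = emeasure lborel (ball (0::'a) 1)"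
  have [measurable]: "B \<in> borel_measurable borel"
    unfolding B_def by (rule borel_measurable_indicator) simp
  have T_lin: "linear T"
    using T by (rule orthogonal_transformation_linear)
  have [measurable]: "T \<in> borel_measurable borel"
    using T_lin linear_continuous_on linear_conv_bounded_linear borel_measurable_continuous_onI
    by blast
  have B_norm: "B (- T x) = B x" for x
    using T by (simp add: B_def indicator_def orthogonal_transformation_norm)
  have intB: "(\<integral>\<^sup>+x. B x \<partial>lborel) = vol"
    by (simp add: B_def vol_def)
  have "(\<integral>\<^sup>+x. F (T x) \<partial>lborel) * vol = (\<integral>\<^sup>+x. F (T x) * (\<integral>\<^sup>+y. B (- T x + y) \<partial>lborel) \<partial>lborel)"
    by (subst nn_integral_lborel_shift) (simp_all add: intB nn_integral_multc)
  also have "\<dots> = (\<integral>\<^sup>+x. \<integral>\<^sup>+y. F (T x) * B (- T x + y) \<partial>lborel \<partial>lborel)"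
    by (simp add: nn_integral_cmult)
  also have "\<dots> = (\<integral>\<^sup>+y. \<integral>\<^sup>+x. F (T x) * B (- T x + y) \<partial>lborel \<partial>lborel)"
    by (rule lborel_pair.Fubini') measurable
  also have "\<dots> = (\<integral>\<^sup>+y. \<integral>\<^sup>+x. F (y + T x) * B (- T x) \<partial>lborel \<partial>lborel)"
  proof (rule nn_integral_cong)
    fix y :: 'a
    \<comment> \<open>Shifting \<open>x\<close> by a preimage \<open>v\<close> of \<open>y\<close>
      turns \<open>T x\<close> into \<open>y + T x\<close>, and in the argument of \<open>B\<close>
      the two occurrences of \<open>y\<close> cancel.\<close>
    obtain v where v: "y = T v"
      using orthogonal_transformation_surj[OF T] by (metis surjD)
    have "(\<integral>\<^sup>+x. F (T x) * B (- T x + y) \<partial>lborel) =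
          (\<integral>\<^sup>+x. F (T (v + x)) * B (- T (v + x) + y) \<partial>lborel)"
      by (rule nn_integral_lborel_shift[symmetric]) measurable
    then show "(\<integral>\<^sup>+x. F (T x) * B (- T x + y) \<partial>lborel) = (\<integral>\<^sup>+x. F (y + T x) * B (- T x) \<partial>lborel)"
      by (simp add: v linear_add[OF T_lin])
  qed
  also have "\<dots> = (\<integral>\<^sup>+x. \<integral>\<^sup>+y. F (y + T x) * B (- T x) \<partial>lborel \<partial>lborel)"
    by (rule lborel_pair.Fubini') measurable
  also have "\<dots> = (\<integral>\<^sup>+x. (\<integral>\<^sup>+y. F (T x + y) \<partial>lborel) * B x \<partial>lborel)"
    by (simp add: B_norm nn_integral_multc add.commute)
  also have "\<dots> = (\<integral>\<^sup>+x. F x \<partial>lborel) * vol"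
    by (simp add: nn_integral_lborel_shift nn_integral_cmult intB)
  finally have "(\<integral>\<^sup>+x. F (T x) \<partial>lborel) * vol = (\<integral>\<^sup>+x. F x \<partial>lborel) * vol" .
  \<comment> \<open>Cancelling \<open>vol\<close> among extended nonnegative reals requires it to be
    neither zero nor infinite.\<close>
  moreover have "vol \<noteq> 0" "vol \<noteq> \<infinity>"
    using unit_ball_vol_pos[of "real DIM('a)"]
    by (simp_all add: vol_def emeasure_ball ennreal_eq_0_iff not_le del: unit_ball_vol_pos)
  ultimately show ?thesis
    by (metis ennreal_mult_divide_eq infinity_ennreal_def)
qed

section \<open>The Poisson kernel and the Poisson formula\<close>

text \<open>Here \<open>z\<close> is the boundary point and \<open>w\<close> the interior point. The
  radius is read off from \<open>z\<close>, so one formula serves all circles about 0. The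
  normalisation is the one for the parameter \<open>t\<close> in [0,1], with total mass 1.\<close>

definition poisson_kernel :: "complex \<Rightarrow> complex \<Rightarrow> real" where
  "poisson_kernel z w = ((norm z)\<^sup>2 - (norm w)\<^sup>2) / (norm (z - w))\<^sup>2"

lemma poisson_kernel_nonneg: "norm w \<le> norm z \<Longrightarrow> 0 \<le> poisson_kernel z w"
  by (simp add: poisson_kernel_def)

lemma poisson_kernel_rotate:
  assumes "norm c = 1"
  shows "poisson_kernel (c * z) (c * w) = poisson_kernel z w"
  using assms by (simp add: poisson_kernel_def norm_mult flip: right_diff_distrib)

lemma poisson_kernel_cnj: "poisson_kernel (cnj z) (cnj w) = poisson_kernel z w"
  by (simp add: poisson_kernel_def flip: complex_cnj_diff)

text \<open>Rotations leave the kernel unchanged, so only the difference of the two angles matters,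
  and conjugation reverses its sign. This symmetry makes the kernel integrate to 1 in the angle of
  the interior point as well.\<close>

lemma poisson_kernel_cis_swap:
  "poisson_kernel (cis s * z) (cis t * w) = poisson_kernel (cis t * cnj z) (cis s * cnj w)"
proof -
  have "poisson_kernel (cis s * z) (cis t * w) =
        poisson_kernel (cis (- s - t) * (cis s * z)) (cis (- s - t) * (cis t * w))"
    by (simp add: poisson_kernel_rotate)
  also have "\<dots> = poisson_kernel (cis (- t) * z) (cis (- s) * w)"
    by (simp add: cis_mult flip: mult.assoc)
  also have "\<dots> = poisson_kernel (cnj (cis t * cnj z)) (cnj (cis s * cnj w))"
    by (simp add: cis_cnj)
  finally show ?thesis
    by (simp only: poisson_kernel_cnj)
qed

text \<open>
  Cauchy's formula for \<open>u \<mapsto> h u * (s\<^sup>2 - \<bar>w\<bar>\<^sup>2) / (s\<^sup>2 - cnj w * u)\<close>, which takes the value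
  \<open>h w\<close> at \<open>w\<close>: since \<open>s\<^sup>2 = u * cnj u\<close> on the circle, its integrand is the Poisson integrand.
\<close>

lemma poisson_formula_circle:
  fixes h :: "complex \<Rightarrow> complex"
  assumes h: "h holomorphic_on cball 0 s" and w: "norm w < s"
  shows "((\<lambda>t. poisson_kernel (cis (2 * pi * t) * s) w * h (cis (2 * pi * t) * s))
           has_integral h w) {0..1}"
proof -
  have s: "s > 0" using w norm_ge_zero[of w] by linarith
  \<comment> \<open>The only possible zero of the denominator is the reflection of \<open>w\<close>
    in the circle, which lies outside the closed disk.\<close>
  have ne: "of_real (s\<^sup>2) - cnj w * u \<noteq> 0" if "u \<in> cball 0 s" for u :: complex
  proof
    assume "of_real (s\<^sup>2) - cnj w * u = 0"
    then have "norm (of_real (s\<^sup>2) :: complex) = norm (cnj w * u)"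
      by simp
    then have "s\<^sup>2 = norm w * norm u"
      by (simp add: norm_mult norm_power)
    also have "\<dots> \<le> norm w * s"
      using that by (intro mult_left_mono) auto
    also have "\<dots> < s * s"
      using w s by simp
    finally show False by (simp add: power2_eq_square)
  qed
  define G where "G u = h u * of_real (s\<^sup>2 - (norm w)\<^sup>2) / (of_real (s\<^sup>2) - cnj w * u)" for u
  have G_hol: "G holomorphic_on cball 0 s"
    unfolding G_def using ne by (intro holomorphic_intros h) auto
  have "((\<lambda>u. G u / (u - w)) has_contour_integral (2 * of_real pi * \<i> * G w)) (circlepath 0 s)"
    using G_hol w by (intro Cauchy_integral_circlepath)
      (auto intro: holomorphic_on_imp_continuous_on holomorphic_on_subset)
  then have "((\<lambda>t. G (circlepath 0 s t) / (circlepath 0 s t - w) *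
      vector_derivative (circlepath 0 s) (at t within {0..1}))
      has_integral 2 * of_real pi * \<i> * G w) {0..1}"
    by (simp add: has_contour_integral_def)
  then have cauchy: "((\<lambda>t. 1 / (2 * of_real pi * \<i>) * (G (circlepath 0 s t) / (circlepath 0 s t - w) *
      vector_derivative (circlepath 0 s) (at t within {0..1})))
      has_integral 1 / (2 * of_real pi * \<i>) * (2 * of_real pi * \<i> * G w)) {0..1}"
    by (rule has_integral_mult_right)
  have G_w: "1 / (2 * of_real pi * \<i>) * (2 * of_real pi * \<i> * G w) = h w"
  proof -
    have "of_real (s\<^sup>2 - (norm w)\<^sup>2) = of_real (s\<^sup>2) - cnj w * w"
      by (simp only: of_real_diff complex_norm_square mult.commute)
    then have "G w = h w"
      using ne[of w] w by (simp only: G_def) simp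
    then show ?thesis by simp
  qed
  have "1 / (2 * of_real pi * \<i>) * (G (circlepath 0 s t) / (circlepath 0 s t - w) *
      vector_derivative (circlepath 0 s) (at t within {0..1})) =
      poisson_kernel (cis (2 * pi * t) * s) w * h (cis (2 * pi * t) * s)"
    if t: "t \<in> {0..1}" for t
  proof -
    define u where "u = cis (2 * pi * t) * of_real s"
    have path: "circlepath 0 s t = u"
      by (simp add: circlepath u_def cis_conv_exp mult_ac)
    have deriv: "vector_derivative (circlepath 0 s) (at t within {0..1}) = 2 * of_real pi * \<i> * u"
      using t by (simp add: vector_derivative_circlepath01 u_def cis_conv_exp mult_ac)
    have u: "norm u = s"
      using s by (simp add: u_def norm_mult)
    then have uw: "u - w \<noteq> 0" using w by auto
    have u0: "u \<noteq> 0" using u s by auto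
    have sq: "of_real (s\<^sup>2) = u * cnj u"
      using u by (metis complex_norm_square)
    have "of_real (poisson_kernel u w) = (u * cnj u - w * cnj w) / ((u - w) * (cnj u - cnj w))"
      unfolding poisson_kernel_def of_real_divide of_real_diff complex_norm_square by simp
    moreover have "1 / (2 * of_real pi * \<i>) * (G u / (u - w) * (2 * of_real pi * \<i> * u)) = G u / (u - w) * u"
    proof -
      have "1 / k * (x * (k * u)) = x * u" if "k \<noteq> 0" for k x :: complex
        using that by simp
      from this[of "2 * of_real pi * \<i>"] show ?thesis by simp
    qed
    \<comment> \<open>On the circle the denominator of \<open>G\<close> contains a factor
      \<open>u\<close>. It cancels the \<open>u\<close> contributed by the velocity of the path,
      leaving the squared modulus of \<open>u - w\<close>.\<close>
    moreover have "G u / (u - w) * u = (u * cnj u - w * cnj w) / ((u - w) * (cnj u - cnj w)) * h u"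
    proof -
      have "of_real (s\<^sup>2) - cnj w * u = u * (cnj u - cnj w)"
        unfolding sq by (simp add: algebra_simps)
      moreover have "of_real (s\<^sup>2 - (norm w)\<^sup>2) = u * cnj u - w * cnj w"
        by (simp only: of_real_diff sq complex_norm_square)
      ultimately show ?thesis
        using u0 by (simp add: G_def mult_ac)
    qed
    ultimately show ?thesis
      unfolding path deriv u_def[symmetric] by simp
  qed
  from has_integral_eq[OF this cauchy] show ?thesis
    unfolding G_w .
qed

text \<open>Rotating by the unit number \<open>z / norm z\<close> reduces this to the circle
  parametrised from its positive real point. As \<open>norm z < 1\<close>, the rotated function is
  holomorphic on the closed disk bounded by that circle.\<close>

lemma poisson_formula:
  fixes h :: "complex \<Rightarrow> complex"
  assumes h: "h holomorphic_on ball 0 1" and "norm w < norm z" "norm z < 1"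
  shows "((\<lambda>t. poisson_kernel (cis (2 * pi * t) * z) w * h (cis (2 * pi * t) * z))
           has_integral h w) {0..1}"
proof -
  define c where "c = z / norm z"
  have z: "z \<noteq> 0" using assms(2) by auto
  then have c: "norm c = 1" "c * norm z = z" "c \<noteq> 0"
    by (auto simp: c_def norm_divide)
  have "(\<lambda>u. h (c * u)) holomorphic_on cball 0 (norm z)"
    using assms c by (intro holomorphic_on_compose_gen[OF _ h, unfolded o_def] holomorphic_intros)
      (auto simp: norm_mult)
  from poisson_formula_circle[OF this, of "w / c"] assms c
  have "((\<lambda>t. poisson_kernel (cis (2 * pi * t) * norm z) (w / c) * h (c * (cis (2 * pi * t) * norm z)))
           has_integral h w) {0..1}"
    by (simp add: norm_divide)
  moreover have cz: "c * (cis (2 * pi * t) * norm z) = cis (2 * pi * t) * z" for t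
    using c by (metis mult.left_commute)
  moreover have "poisson_kernel (cis (2 * pi * t) * norm z) (w / c) = poisson_kernel (cis (2 * pi * t) * z) w" for t
    using poisson_kernel_rotate[OF c(1), of "cis (2 * pi * t) * norm z" "w / c"] c(3)
    by (simp only: cz) simp
  ultimately show ?thesis by simp
qed

lemma poisson_kernel_has_integral:
  assumes "norm w < norm z" "norm z < 1"
  shows "((\<lambda>t. poisson_kernel (cis (2 * pi * t) * z) w) has_integral 1) {0..1}"
proof -
  have "((\<lambda>t. of_real (poisson_kernel (cis (2 * pi * t) * z) w) * 1 :: complex) has_integral 1) {0..1}"
    using assms by (intro poisson_formula[where h = "\<lambda>_. 1"]) auto
  from has_integral_linear[OF this bounded_linear_Re] show ?thesis
    by (simp add: o_def)
qed

lemma continuous_on_poisson_kernel [continuous_intros]: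
  assumes "continuous_on A a" "continuous_on A b" "\<And>x. x \<in> A \<Longrightarrow> a x \<noteq> b x"
  shows "continuous_on A (\<lambda>x. poisson_kernel (a x) (b x))"
  unfolding poisson_kernel_def using assms by (intro continuous_intros) auto

section \<open>Jensen's inequality and monotonicity of circular means\<close>

text \<open>Convexity: the graph of the power function lies above its tangent at \<open>c\<close>.
  This is Young's inequality for \<open>x\<close> and \<open>c powr (p - 1)\<close> with
  \<open>q\<close> the conjugate exponent of \<open>p\<close>. At \<open>c = 0\<close> the left side
  is 0, by the convention that 0 to any power is 0.\<close>

lemma powr_tangent_le:
  fixes x c p :: real
  assumes "1 < p" "0 \<le> x" "0 \<le> c"
  shows "c powr p + p * c powr (p - 1) * (x - c) \<le> x powr p"
proof (cases "c = 0")
  case False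
  define q where "q = p / (p - 1)"
  have q: "q > 1" "1 / p + 1 / q = 1" "(p - 1) * q = p"
    using assms by (auto simp: q_def field_simps)
  have "x * c powr (p - 1) \<le> x powr p / p + (c powr (p - 1)) powr q / q"
    using assms q by (intro Youngs_inequality) auto
  also have "(c powr (p - 1)) powr q = c powr p"
    using q by (simp add: powr_powr)
  finally have "p * (x * c powr (p - 1)) \<le> p * (x powr p / p + c powr p * (1 / q))"
    using assms by (intro mult_left_mono) auto
  also have "1 / q = 1 - 1 / p" using q by simp
  also have "p * (x powr p / p + c powr p * (1 - 1 / p)) = x powr p + (p - 1) * c powr p"
    using assms by (simp add: field_simps)
  finally have "p * (x * c powr (p - 1)) \<le> x powr p + (p - 1) * c powr p" .
  moreover have "c powr (p - 1) * c = c powr p"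
    using False assms by (simp add: powr_diff)
  ultimately show ?thesis
    by (simp add: algebra_simps)
qed (use assms in auto)

text \<open>Jensen's inequality for the probability density \<open>k\<close>, proved by averaging
  the tangent inequality at the point \<open>c = norm I\<close>. Continuity supplies the
  integrability.\<close>

lemma norm_weighted_integral_powr_le:
  fixes k :: "real \<Rightarrow> real" and F :: "real \<Rightarrow> 'a::banach"
  assumes p: "1 < p" and k0: "\<And>t. t \<in> {a..b} \<Longrightarrow> 0 \<le> k t"
    and k: "(k has_integral 1) {a..b}" and "continuous_on {a..b} k" "continuous_on {a..b} F"
    and I: "((\<lambda>t. k t *\<^sub>R F t) has_integral I) {a..b}"
  shows "norm I powr p \<le> integral {a..b} (\<lambda>t. k t * norm (F t) powr p)"
proof -
  define c where "c = norm I"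
  define J where "J = integral {a..b} (\<lambda>t. k t * norm (F t))"
  have int1: "(\<lambda>t. k t * norm (F t)) integrable_on {a..b}"
    by (intro integrable_continuous_interval continuous_intros assms)
  have int2: "(\<lambda>t. k t * norm (F t) powr p) integrable_on {a..b}"
    using p by (intro integrable_continuous_interval continuous_intros continuous_on_powr' assms) auto
  have "c \<le> J"
    unfolding c_def J_def integral_unique[OF I, symmetric]
    by (rule integral_norm_bound_integral) (use I int1 k0 in \<open>auto simp: integrable_on_def\<close>)
  \<comment> \<open>The tangent slope is nonnegative and \<open>c \<le> J\<close>, so the added
    linear term is nonnegative.\<close>
  then have "c powr p \<le> c powr p + p * c powr (p - 1) * (J - c)"
    using p by simp
  \<comment> \<open>Because \<open>k\<close> has mass 1, the tangent line evaluated at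
    \<open>J\<close> is the \<open>k\<close>-average of its values at
    \<open>norm (F t)\<close>.\<close>
  also have "((\<lambda>t. k t * (c powr p - p * c powr (p - 1) * c) + (k t * norm (F t)) * (p * c powr (p - 1)))
      has_integral 1 * (c powr p - p * c powr (p - 1) * c) + J * (p * c powr (p - 1))) {a..b}"
    unfolding J_def by (intro has_integral_add has_integral_mult_left k integrable_integral int1)
  then have "c powr p + p * c powr (p - 1) * (J - c) =
      integral {a..b} (\<lambda>t. k t * (c powr p + p * c powr (p - 1) * (norm (F t) - c)))"
    by (intro integral_unique[symmetric]) (simp add: algebra_simps)
  also have "\<dots> \<le> integral {a..b} (\<lambda>t. k t * norm (F t) powr p)"
  proof (rule integral_le)
    show "(\<lambda>t. k t * (c powr p + p * c powr (p - 1) * (norm (F t) - c))) integrable_on {a..b}"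
      by (intro integrable_continuous_interval continuous_intros assms)
    show "k t * (c powr p + p * c powr (p - 1) * (norm (F t) - c)) \<le> k t * norm (F t) powr p"
      if "t \<in> {a..b}" for t
      using that k0 p by (intro mult_left_mono powr_tangent_le) (auto simp: c_def)
  qed (fact int2)
  finally show ?thesis by (simp add: c_def)
qed

text \<open>Jensen bounds the value at each point of the inner circle by a Poisson average over the
  outer one. Integrating over the inner angle and exchanging the integrals leaves the kernel's
  integral in the inner angle, which is 1.\<close>

lemma circle_mean_powr_mono:
  assumes h: "h holomorphic_on ball 0 1" and g: "g holomorphic_on ball 0 1"
    and f: "\<And>z. z \<in> ball 0 1 \<Longrightarrow> f z = h z + cnj (g z)"
    and p: "1 < p" and wz: "norm w < norm z" "norm z < 1"
  shows "integral {0..1} (\<lambda>t. norm (f (cis (2 * pi * t) * w)) powr p)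
       \<le> integral {0..1} (\<lambda>t. norm (f (cis (2 * pi * t) * z)) powr p)"
proof -
  have "continuous_on (ball 0 1) (\<lambda>z. h z + cnj (g z))"
    by (intro continuous_intros holomorphic_on_imp_continuous_on h g)
  then have f_cont: "continuous_on (ball 0 1) f"
    by (rule continuous_on_eq) (simp add: f)
  have cont: "continuous_on A (\<lambda>x. f (cis (2 * pi * e x) * v))"
    if "norm v < 1" "continuous_on A e" for v and e :: "'b::t2_space \<Rightarrow> real" and A
    by (rule continuous_on_compose2[OF f_cont]) (use that in \<open>auto intro!: continuous_intros simp: norm_mult\<close>)
  define K where "K s t = poisson_kernel (cis (2 * pi * t) * z) (cis (2 * pi * s) * w)" for s t
  have K_cont: "continuous_on A (\<lambda>x. K (a x) (b x))"
    if "continuous_on A a" "continuous_on A b" for A and a b :: "'b::t2_space \<Rightarrow> real"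
  proof -
    have "cis (2 * pi * b x) * z \<noteq> cis (2 * pi * a x) * w" for x
      using wz by (metis less_irrefl mult_1 norm_cis norm_mult)
    then show ?thesis
      unfolding K_def using that by (intro continuous_intros) auto
  qed
  have K_int: "((\<lambda>t. K s t) has_integral 1) {0..1}" for s
    unfolding K_def using wz by (intro poisson_kernel_has_integral) (auto simp: norm_mult)
  \<comment> \<open>After the swap \<open>s\<close> is the angle of the boundary point
    \<open>cnj z\<close>, whose modulus is that of \<open>z\<close>, so the mass formula applies
    again.\<close>
  have K_int': "((\<lambda>s. K s t) has_integral 1) {0..1}" for t
    unfolding K_def poisson_kernel_cis_swap[of "2 * pi * t"]
    using wz by (intro poisson_kernel_has_integral) (auto simp: norm_mult)
  have K_nonneg: "0 \<le> K s t" for s t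
    unfolding K_def using wz by (intro poisson_kernel_nonneg) (auto simp: norm_mult)
  have poisson: "((\<lambda>t. K s t *\<^sub>R f (cis (2 * pi * t) * z)) has_integral f (cis (2 * pi * s) * w)) {0..1}" for s
  proof -
    let ?w = "cis (2 * pi * s) * w"
    have *: "((\<lambda>t. of_real (K s t) * k (cis (2 * pi * t) * z)) has_integral k ?w) {0..1}"
      if "k holomorphic_on ball 0 1" for k :: "complex \<Rightarrow> complex"
      unfolding K_def using wz by (intro poisson_formula[OF that]) (auto simp: norm_mult)
    \<comment> \<open>The kernel is real, so the formula for \<open>g\<close> survives conjugation
      and can be added to the one for \<open>h\<close>.\<close>
    have "((\<lambda>t. of_real (K s t) * h (cis (2 * pi * t) * z) + cnj (of_real (K s t) * g (cis (2 * pi * t) * z)))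
        has_integral h ?w + cnj (g ?w)) {0..1}"
      by (intro has_integral_add * h has_integral_linear[OF *[OF g] bounded_linear_cnj, unfolded o_def])
    moreover have "f ?w = h ?w + cnj (g ?w)"
      using wz by (intro f) (auto simp: norm_mult)
    moreover have "K s t *\<^sub>R f (cis (2 * pi * t) * z) = of_real (K s t) * h (cis (2 * pi * t) * z) +
        cnj (of_real (K s t) * g (cis (2 * pi * t) * z))" for t
    proof -
      have "f (cis (2 * pi * t) * z) = h (cis (2 * pi * t) * z) + cnj (g (cis (2 * pi * t) * z))"
        using wz by (intro f) (auto simp: norm_mult)
      then show ?thesis
        by (simp add: scaleR_conv_of_real algebra_simps)
    qed
    ultimately show ?thesis by simp
  qed
  have Kf_cont: "continuous_on A (\<lambda>x. K (a x) (b x) * norm (f (cis (2 * pi * b x) * z)) powr p)"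
    if "continuous_on A a" "continuous_on A b" for A and a b :: "'b::t2_space \<Rightarrow> real"
    using p wz that by (intro continuous_intros continuous_on_powr' K_cont cont) auto
  have "integral {0..1} (\<lambda>s. norm (f (cis (2 * pi * s) * w)) powr p) \<le>
        integral {0..1} (\<lambda>s. integral {0..1} (\<lambda>t. K s t * norm (f (cis (2 * pi * t) * z)) powr p))"
  proof (rule integral_le)
    show "(\<lambda>s. norm (f (cis (2 * pi * s) * w)) powr p) integrable_on {0..1}"
      using p wz by (intro integrable_continuous_interval continuous_on_powr' continuous_intros cont) auto
    show "(\<lambda>s. integral {0..1} (\<lambda>t. K s t * norm (f (cis (2 * pi * t) * z)) powr p)) integrable_on {0..1}"
    proof (rule integrable_continuous_interval)
      have "continuous_on {0..1} (\<lambda>s. integral (cbox 0 1) (\<lambda>t. K s t * norm (f (cis (2 * pi * t) * z)) powr p))"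
        unfolding case_prod_unfold
        by (intro integral_continuous_on_param[unfolded case_prod_unfold] Kf_cont continuous_intros)
      then show "continuous_on {0..1} (\<lambda>s. integral {0..1} (\<lambda>t. K s t * norm (f (cis (2 * pi * t) * z)) powr p))"
        by simp
    qed
    show "norm (f (cis (2 * pi * s) * w)) powr p \<le>
        integral {0..1} (\<lambda>t. K s t * norm (f (cis (2 * pi * t) * z)) powr p)" for s
      using wz by (intro norm_weighted_integral_powr_le p K_nonneg K_int poisson K_cont cont continuous_intros)
  qed
  also have "\<dots> = integral {0..1} (\<lambda>t. integral {0..1} (\<lambda>s. K s t * norm (f (cis (2 * pi * t) * z)) powr p))"
  proof -
    have "continuous_on (cbox (0, 0) (1, 1)) (\<lambda>(s, t). K s t * norm (f (cis (2 * pi * t) * z)) powr p)"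
      unfolding case_prod_unfold by (intro Kf_cont continuous_intros)
    from integral_swap_continuous[OF this] show ?thesis by simp
  qed
  also have "\<dots> = integral {0..1} (\<lambda>t. norm (f (cis (2 * pi * t) * z)) powr p)"
    by (simp add: integral_unique[OF K_int'])
  finally show ?thesis .
qed

section \<open>Radial integration and averaging over rotations\<close>

text \<open>For \<open>x\<close> in [0,1] the set where \<open>1 - (norm z)\<^sup>2\<close> exceeds
  \<open>x\<close> is a disk of area \<open>pi * (1 - x)\<close>, so this quantity is uniformly
  distributed. This does the work of polar coordinates for radial integrands.\<close>

lemma distr_one_minus_norm_square:
  "distr (restrict_space lborel (ball 0 1)) borel (\<lambda>z::complex. 1 - (norm z)\<^sup>2)
     = density lborel (\<lambda>x. ennreal pi * indicator {0..1} x)" (is "?M = ?N")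
proof (rule measure_eqI_lessThan)
  fix x :: real
  have "emeasure ?M {x<..} = emeasure (restrict_space lborel (ball 0 1))
      ((\<lambda>z::complex. 1 - (norm z)\<^sup>2) -` {x<..} \<inter> space (restrict_space lborel (ball 0 1)))"
    by (intro emeasure_distr measurable_restrict_space1) auto
  also have "\<dots> = emeasure lborel ((\<lambda>z::complex. 1 - (norm z)\<^sup>2) -` {x<..} \<inter> ball 0 1)"
    by (subst emeasure_restrict_space) (auto simp: space_restrict_space)
  \<comment> \<open>Clamping \<open>x\<close> to [0,1] covers all cases by one formula: the whole
    disk for negative \<open>x\<close>, and the empty ball of radius 0 for \<open>x\<close> at least
    1.\<close>
  also have "(\<lambda>z::complex. 1 - (norm z)\<^sup>2) -` {x<..} \<inter> ball 0 1 = ball 0 (sqrt (1 - min 1 (max 0 x)))"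
  proof (rule set_eqI)
    fix z :: complex
    have "(norm z < sqrt (1 - min 1 (max 0 x))) = ((norm z)\<^sup>2 < 1 - min 1 (max 0 x))"
      using real_sqrt_less_iff[of "(norm z)\<^sup>2" "1 - min 1 (max 0 x)"] by simp
    moreover have "x < 1 - q \<and> q < 1 \<longleftrightarrow> q < 1 - min 1 (max 0 x)" if "0 \<le> q" for q
      using that by (auto simp: min_def max_def)
    moreover have "(norm z < 1) = ((norm z)\<^sup>2 < 1)"
      by (simp add: abs_square_less_1)
    ultimately show "z \<in> (\<lambda>z::complex. 1 - (norm z)\<^sup>2) -` {x<..} \<inter> ball 0 1 \<longleftrightarrow>
        z \<in> ball 0 (sqrt (1 - min 1 (max 0 x)))"
      by simp
  qed
  also have "emeasure lborel (ball (0::complex) (sqrt (1 - min 1 (max 0 x)))) = ennreal (pi * (1 - min 1 (max 0 x)))"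
    by (simp add: emeasure_ball unit_ball_vol_2)
  finally have M: "emeasure ?M {x<..} = ennreal (pi * (1 - min 1 (max 0 x)))" .
  then show "emeasure ?M {x<..} < \<infinity>" by simp
  have "emeasure ?N {x<..} = (\<integral>\<^sup>+y. ennreal pi * indicator ({0..1} \<inter> {x<..}) y \<partial>lborel)"
    by (subst emeasure_density) (auto simp: indicator_inter_arith mult.assoc)
  also have "\<dots> = ennreal pi * emeasure lborel ({0..1} \<inter> {x<..})"
    by (subst nn_integral_cmult) auto
  also have "emeasure lborel ({0..1} \<inter> {x<..}) = ennreal (1 - min 1 (max 0 x))"
  proof (cases "x < 0")
    case True
    then have "{0..1} \<inter> {x<..} = {0..1::real}" by auto
    then show ?thesis using True by simp
  next
    case False
    then have "{0..1} \<inter> {x<..} = {x<..1}" by auto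
    then show ?thesis using False by (cases "x \<le> 1") auto
  qed
  finally show "emeasure ?M {x<..} = emeasure ?N {x<..}"
    unfolding M by (simp add: ennreal_mult)
qed auto

text \<open>In the variable \<open>x = 1 - (norm z)\<^sup>2\<close> the integral becomes
  \<open>pi\<close> times that of \<open>x powr b\<close> from 0 to \<open>1 - r\<^sup>2\<close>,
  which converges at 0 since \<open>b > - 1\<close>.\<close>

lemma nn_integral_annulus_powr:
  assumes b: "b > - 1" and r: "0 \<le> r" "r < 1"
  shows "(\<integral>\<^sup>+z. ennreal ((1 - (norm z)\<^sup>2) powr b) * indicator {z. r < norm z \<and> norm z < 1} z
            \<partial>(lborel :: complex measure))
       = ennreal (pi * ((1 - r\<^sup>2) powr (b + 1) / (b + 1)))"
proof -
  let ?R = "restrict_space lborel (ball (0::complex) 1)"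
  define G :: "real \<Rightarrow> ennreal" where "G x = ennreal (x powr b) * indicator {..<1 - r\<^sup>2} x" for x
  have [measurable]: "G \<in> borel_measurable borel" unfolding G_def by measurable
  have r2: "r\<^sup>2 < 1" using r by (simp add: power_less_one_iff abs_square_less_1)
  have iff: "1 - (norm z)\<^sup>2 < 1 - r\<^sup>2 \<longleftrightarrow> r < norm z" for z :: complex
    using r by (auto intro: power_strict_mono dest: power_less_imp_less_base)
  have "(\<integral>\<^sup>+z. ennreal ((1 - (norm z)\<^sup>2) powr b) * indicator {z. r < norm z \<and> norm z < 1} z
            \<partial>(lborel :: complex measure))
      = (\<integral>\<^sup>+z. G (1 - (norm z)\<^sup>2) * indicator (ball 0 1) z \<partial>(lborel :: complex measure))"
    by (intro nn_integral_cong) (auto simp: G_def indicator_def iff)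
  also have "\<dots> = (\<integral>\<^sup>+z. G (1 - (norm z)\<^sup>2) \<partial>?R)"
    by (rule nn_integral_restrict_space[symmetric]) simp
  also have "\<dots> = (\<integral>\<^sup>+x. G x \<partial>distr ?R borel (\<lambda>z. 1 - (norm z)\<^sup>2))"
    by (intro nn_integral_distr[symmetric] measurable_restrict_space1) measurable
  also have "\<dots> = (\<integral>\<^sup>+x. (ennreal pi * indicator {0..1} x) * G x \<partial>lborel)"
    unfolding distr_one_minus_norm_square by (rule nn_integral_density) measurable
  also have "\<dots> = (\<integral>\<^sup>+x. ennreal pi * (ennreal (x powr b) * indicator {0..1 - r\<^sup>2} x) \<partial>lborel)"
  proof (rule nn_integral_cong_AE)
    have le1: "x \<le> 1" if "x \<le> 1 - r\<^sup>2" for x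
      using that zero_le_power2[of r] by linarith
    \<comment> \<open>The strict inequality \<open>r < norm z\<close> excludes the endpoint
      \<open>1 - r\<^sup>2\<close>, a null set.\<close>
    show "AE x in lborel. (ennreal pi * indicator {0..1} x) * G x =
        ennreal pi * (ennreal (x powr b) * indicator {0..1 - r\<^sup>2} x)"
      using AE_lborel_singleton[of "1 - r\<^sup>2"]
      by eventually_elim (auto simp: G_def indicator_def dest: le1)
  qed
  also have "\<dots> = ennreal pi * (\<integral>\<^sup>+x. ennreal (x powr b) * indicator {0..1 - r\<^sup>2} x \<partial>lborel)"
    by (rule nn_integral_cmult) measurable
  also have "(\<integral>\<^sup>+x. ennreal (x powr b) * indicator {0..1 - r\<^sup>2} x \<partial>lborel) =
      ennreal ((1 - r\<^sup>2) powr (b + 1) / (b + 1))"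
    using b r2 by (intro nn_integral_has_integral_lebesgue' has_integral_powr_from_0) auto
  finally show ?thesis
    using b by (subst ennreal_mult) simp_all
qed

text \<open>Multiplication by \<open>cis \<theta>\<close> is orthogonal, so each rotated integral
  equals the original one. Averaging over the angle and applying Tonelli moves the average
  inside.\<close>

lemma nn_integral_rotation_average:
  fixes F :: "complex \<Rightarrow> ennreal"
  assumes [measurable]: "F \<in> borel_measurable borel"
  shows "(\<integral>\<^sup>+z. F z \<partial>lborel) = (\<integral>\<^sup>+z. (\<integral>\<^sup>+t\<in>{0..1}. F (cis (2 * pi * t) * z) \<partial>lborel) \<partial>lborel)"
proof -
  have [measurable]: "cis \<in> borel_measurable borel"
    by (intro borel_measurable_continuous_onI continuous_intros)
  have "(\<integral>\<^sup>+z. F (cis \<theta> * z) \<partial>lborel) = (\<integral>\<^sup>+z. F z \<partial>lborel)" for \<theta>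
    by (rule nn_integral_lborel_orthogonal)
       (auto simp: orthogonal_transformation norm_mult intro!: linearI algebra_simps)
  then have "(\<integral>\<^sup>+z. F z \<partial>lborel) =
      (\<integral>\<^sup>+t. (\<integral>\<^sup>+z. F (cis (2 * pi * t) * z) \<partial>lborel) * indicator {0..1::real} t \<partial>lborel)"
    by (simp add: nn_integral_cmult)
  also have "\<dots> = (\<integral>\<^sup>+t. \<integral>\<^sup>+z. F (cis (2 * pi * t) * z) * indicator {0..1::real} t \<partial>lborel \<partial>lborel)"
    by (simp add: nn_integral_multc)
  also have "\<dots> = (\<integral>\<^sup>+z. (\<integral>\<^sup>+t\<in>{0..1}. F (cis (2 * pi * t) * z) \<partial>lborel) \<partial>lborel)"
    by (rule lborel_pair.Fubini') measurable
  finally show ?thesis .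
qed

section \<open>Comparison of the circle integral with the weighted area integral\<close>

theorem corollary2p3:
  fixes n :: nat and p \<alpha> r :: real and f :: "complex \<Rightarrow> complex"
  assumes "n \<ge> 1" and "1 < p" and "\<alpha> > real n * p - 1"
    and "f \<in> Qh n p \<alpha>"
    and "0 < r" and "r < 1"
  shows "arc_length_integral (circlepath 0 r)
           (\<lambda>z. ennreal (norm (f z) powr p * (1 - (norm z)\<^sup>2) powr (\<alpha> + 1 - real n * p)))
         \<le> ennreal (2 * pi * r * (\<alpha> + 1 - real n * p)) *
           (\<integral>\<^sup>+ z. ennreal (norm (f z) powr p * (1 - (norm z)\<^sup>2) powr (\<alpha> - real n * p)) \<partial>disk_area)"
proof -
  define b where "b = \<alpha> - real n * p"
  have b: "b > - 1" and b1: "\<alpha> + 1 - real n * p = b + 1"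
    using assms(3) by (simp_all add: b_def)
  obtain h g where hol: "h holomorphic_on unit_disk" "g holomorphic_on unit_disk"
    and f: "\<And>z. z \<in> unit_disk \<Longrightarrow> f z = h z + cnj (g z)"
    using assms(4) unfolding Qh_def by blast
  have "continuous_on unit_disk (\<lambda>z. h z + cnj (g z))"
    by (intro continuous_intros holomorphic_on_imp_continuous_on hol)
  then have f_cont: "continuous_on unit_disk f"
    by (rule continuous_on_eq) (simp add: f)
  have circle_cont: "continuous_on A (\<lambda>t. norm (f (cis (2 * pi * t) * z)) powr p)" if "norm z < 1" for z A
    using assms(2) that
    by (intro continuous_on_powr' continuous_on_norm continuous_on_compose2[OF f_cont] continuous_intros)
       (auto simp: norm_mult)
  \<comment> \<open>With the parameter in [0,1] this is a normalised average; the constant speed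
    \<open>2 * pi * r\<close> of the path enters separately in the arc length integral.\<close>
  define mean where "mean z = integral {0..1} (\<lambda>t. norm (f (cis (2 * pi * t) * z)) powr p)" for z
  have mean: "((\<lambda>t. norm (f (cis (2 * pi * t) * z)) powr p) has_integral mean z) {0..1}"
    if "norm z < 1" for z
    unfolding mean_def by (intro integrable_integral integrable_continuous_interval circle_cont that)
  have mean_nonneg: "0 \<le> mean z" if "norm z < 1" for z
    using mean[OF that] by (rule has_integral_nonneg) simp

  have "arc_length_integral (circlepath 0 r)
           (\<lambda>z. ennreal (norm (f z) powr p * (1 - (norm z)\<^sup>2) powr (b + 1))) =
      (\<integral>\<^sup>+t. ennreal (norm (f (cis (2 * pi * t) * r)) powr p * ((1 - r\<^sup>2) powr (b + 1) * (2 * pi * r)))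
         * indicator {0..1} t \<partial>lborel)"
    unfolding arc_length_integral_def
  proof (intro nn_integral_cong)
    fix t :: real
    have "circlepath 0 r t = cis (2 * pi * t) * r"
      by (simp add: circlepath cis_conv_exp mult_ac)
    moreover have "norm (vector_derivative (circlepath 0 r) (at t within {0..1})) = 2 * pi * r"
      if "t \<in> {0..1}"
    proof -
      have "vector_derivative (circlepath 0 r) (at t within {0..1}) = 2 * pi * \<i> * r * cis (2 * pi * t)"
        using that by (simp add: vector_derivative_circlepath01 cis_conv_exp mult_ac)
      then show ?thesis using assms by (simp add: norm_mult)
    qed
    ultimately show "ennreal (norm (f (circlepath 0 r t)) powr p * (1 - (norm (circlepath 0 r t))\<^sup>2) powr (b + 1)) *
        ennreal (norm (vector_derivative (circlepath 0 r) (at t within {0..1}))) * indicator {0..1} t =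
      ennreal (norm (f (cis (2 * pi * t) * r)) powr p * ((1 - r\<^sup>2) powr (b + 1) * (2 * pi * r))) * indicator {0..1} t"
      using assms by (auto simp: norm_mult indicator_def mult.assoc simp flip: ennreal_mult)
  qed
  also have "\<dots> = ennreal (mean r * ((1 - r\<^sup>2) powr (b + 1) * (2 * pi * r)))"
    using assms by (intro nn_integral_has_integral_lebesgue' has_integral_mult_left mean) auto
  finally have lhs: "arc_length_integral (circlepath 0 r)
      (\<lambda>z. ennreal (norm (f z) powr p * (1 - (norm z)\<^sup>2) powr (b + 1))) =
      ennreal (mean r * ((1 - r\<^sup>2) powr (b + 1) * (2 * pi * r)))" .

  \<comment> \<open>Extension by 0 gives a function on the whole plane, to which the rotation
    average applies and in which the values of \<open>f\<close> off the disk do not appear.\<close>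
  define F :: "complex \<Rightarrow> ennreal"
    where "F z = ennreal (norm (f z) powr p * (1 - (norm z)\<^sup>2) powr b) * indicator unit_disk z" for z
  have weight_cont: "continuous_on unit_disk (\<lambda>z. norm (f z) powr p * (1 - (norm z)\<^sup>2) powr b)"
  proof (intro continuous_on_mult)
    show "continuous_on unit_disk (\<lambda>z. norm (f z) powr p)"
      using assms(2) by (intro continuous_on_powr' continuous_on_norm f_cont continuous_intros) auto
    have "(norm z)\<^sup>2 < 1" if "z \<in> unit_disk" for z :: complex
      using that by (simp add: abs_square_less_1)
    then show "continuous_on unit_disk (\<lambda>z::complex. (1 - (norm z)\<^sup>2) powr b)"
      by (intro continuous_intros) fastforce
  qed
  have "(\<lambda>z. indicator unit_disk z *\<^sub>R (norm (f z) powr p * (1 - (norm z)\<^sup>2) powr b)) \<in> borel_measurable borel"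
    by (intro borel_measurable_continuous_on_indicator weight_cont) simp
  then have "(\<lambda>z. ennreal (indicator unit_disk z *\<^sub>R (norm (f z) powr p * (1 - (norm z)\<^sup>2) powr b))) \<in> borel_measurable borel"
    by measurable
  also have "(\<lambda>z. ennreal (indicator unit_disk z *\<^sub>R (norm (f z) powr p * (1 - (norm z)\<^sup>2) powr b))) = F"
    by (auto simp: F_def indicator_def fun_eq_iff)
  finally have F[measurable]: "F \<in> borel_measurable borel" .

  \<comment> \<open>The constant \<open>mean r\<close> times the mass of the annulus is compared
    pointwise with the rotation average of \<open>F\<close>; where the annulus indicator vanishes
    the bound is trivial.\<close>
  have "ennreal (mean r) * ennreal (pi * ((1 - r\<^sup>2) powr (b + 1) / (b + 1))) =
      (\<integral>\<^sup>+z. ennreal (mean r) *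
         (ennreal ((1 - (norm z)\<^sup>2) powr b) * indicator {z. r < norm z \<and> norm z < 1} z)
         \<partial>(lborel :: complex measure))"
    using assms b by (subst nn_integral_cmult) (simp_all add: nn_integral_annulus_powr)
  also have "\<dots> \<le> (\<integral>\<^sup>+z. (\<integral>\<^sup>+t\<in>{0..1}. F (cis (2 * pi * t) * z) \<partial>lborel) \<partial>lborel)"
  proof (rule nn_integral_mono)
    fix z :: complex
    show "ennreal (mean r) * (ennreal ((1 - (norm z)\<^sup>2) powr b) * indicator {z. r < norm z \<and> norm z < 1} z)
        \<le> (\<integral>\<^sup>+t\<in>{0..1}. F (cis (2 * pi * t) * z) \<partial>lborel)"
    proof (cases "r < norm z \<and> norm z < 1")
      case True
      then have z: "norm z < 1" and rz: "norm (complex_of_real r) < norm z" using assms by auto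
      \<comment> \<open>The weight is radial, so it factors out of the average over the circle
        through \<open>z\<close>.\<close>
      have "(\<integral>\<^sup>+t\<in>{0..1}. F (cis (2 * pi * t) * z) \<partial>lborel) =
          (\<integral>\<^sup>+t. ennreal (norm (f (cis (2 * pi * t) * z)) powr p * (1 - (norm z)\<^sup>2) powr b) * indicator {0..1} t \<partial>lborel)"
        using z by (simp add: F_def norm_mult)
      also have "\<dots> = ennreal (mean z * (1 - (norm z)\<^sup>2) powr b)"
        using z by (intro nn_integral_has_integral_lebesgue' has_integral_mult_left mean) auto
      also have "\<dots> \<ge> ennreal (mean r * (1 - (norm z)\<^sup>2) powr b)"
        unfolding mean_def using hol f assms(2) rz z
        by (intro ennreal_leI mult_right_mono circle_mean_powr_mono) auto
      finally show ?thesis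
        using True assms mean_nonneg[of r] by (simp add: ennreal_mult)
    qed simp
  qed
  also have "\<dots> = (\<integral>\<^sup>+z. F z \<partial>lborel)"
    by (rule nn_integral_rotation_average[symmetric]) measurable
  finally have key: "ennreal (mean r) * ennreal (pi * ((1 - r\<^sup>2) powr (b + 1) / (b + 1))) \<le> (\<integral>\<^sup>+z. F z \<partial>lborel)" .

  have "(\<integral>\<^sup>+z. ennreal (norm (f z) powr p * (1 - (norm z)\<^sup>2) powr b) \<partial>disk_area) =
      ennreal (1 / pi) * (\<integral>\<^sup>+z. ennreal (norm (f z) powr p * (1 - (norm z)\<^sup>2) powr b) \<partial>restrict_space lborel unit_disk)"
    unfolding disk_area_def
  proof (rule nn_integral_scale_measure)
    show "(\<lambda>z. ennreal (norm (f z) powr p * (1 - (norm z)\<^sup>2) powr b)) \<in> borel_measurable (restrict_space lborel unit_disk)"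
      using F unfolding F_def by (subst borel_measurable_restrict_space_iff_ennreal) auto
  qed
  also have "\<dots> = ennreal (1 / pi) * (\<integral>\<^sup>+z. F z \<partial>lborel)"
    by (subst nn_integral_restrict_space) (simp_all add: F_def[abs_def])
  finally have rhs: "(\<integral>\<^sup>+z. ennreal (norm (f z) powr p * (1 - (norm z)\<^sup>2) powr b) \<partial>disk_area) =
      ennreal (1 / pi) * (\<integral>\<^sup>+z. F z \<partial>lborel)" .

  \<comment> \<open>The constants match exactly: \<open>1 / pi\<close> cancels the \<open>pi\<close>
    of the annulus mass, and \<open>b + 1\<close> cancels its denominator. All factors are
    nonnegative, so the product splits in \<open>ennreal\<close>.\<close>
  have "ennreal (mean r * ((1 - r\<^sup>2) powr (b + 1) * (2 * pi * r))) =
      ennreal (2 * pi * r * (b + 1)) * (ennreal (1 / pi) *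
        (ennreal (mean r) * ennreal (pi * ((1 - r\<^sup>2) powr (b + 1) / (b + 1)))))"
  proof -
    have eq: "mean r * ((1 - r\<^sup>2) powr (b + 1) * (2 * pi * r)) =
        2 * pi * r * (b + 1) * (1 / pi * (mean r * (pi * ((1 - r\<^sup>2) powr (b + 1) / (b + 1)))))"
      using b by simp
    have mult4: "ennreal (x * (y * (z * w))) = ennreal x * (ennreal y * (ennreal z * ennreal w))"
      if "0 \<le> x" "0 \<le> y" "0 \<le> z" "0 \<le> w" for x y z w :: real
      using that by (simp add: ennreal_mult)
    show ?thesis
      unfolding eq using b assms mean_nonneg[of r] by (intro mult4) simp_all
  qed
  also have "\<dots> \<le> ennreal (2 * pi * r * (b + 1)) * (ennreal (1 / pi) * (\<integral>\<^sup>+z. F z \<partial>lborel))"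
    by (intro mult_left_mono key) auto
  finally show ?thesis
    unfolding b1 b_def[symmetric] lhs rhs .
qed

end
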